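(* Suppose that $(P,\leq)$ is a poset, viewed as a category, and $m$ and $n$ are cuts of $P$ with $m\leq n$. For $p\in P$ set $$L_p:=\{a\to b\mid b\leq p\}\cup\{\mathrm{Id}_x\mid x\in P\},\qquad R_p:=\{a\to b\mid p\leq a\}\cup\{\mathrm{Id}_x\mid x\in P\}.$$ Then $(L_n,\ R_m,\ L_m\cup R_n)$ (as cofibrations, fibrations, weak equivalences) is a torsion model structure and also a bi-reflective model structure on $P$, the class $\mathcal C$ of cofibrant objects is $P_{\leq n}=\{x\in P\mid x\leq n\}$, the class $\mathcal F$ of fibrant objects is $P_{\geq m}=\{x\in P\mid m\leq x\}$, and the homotopy category is (equivalent to) $P_{[m,n]}=\{x\in P\mid m\leq x\leq n\}$.
   Context: A poset $(P,\leq)$ is a category with objects the elements of $P$ and a unique morphism $p\to q$ iff $p\leq q$; subsets carry the induced order. An element $m\in P$ is a cut if for every $x\in P$ exactly one of $m<x$, $m=x$, $x<m$ holds. A class of morphisms has the two-out-of-three property if whenever two of $f,g,g\circ f$ lie in it so does the third. A model structure on a category $\mathcal A$ is a triple $(\mathrm{CoFib},\mathrm{Fib},\mathrm{Weq})$ of classes of morphisms such that, with $\mathrm{TCoFib}:=\mathrm{CoFib}\cap\mathrm{Weq}$ and $\mathrm{TFib}:=\mathrm{Fib}\cap\mathrm{Weq}$: (CM1) $\mathrm{Weq}$ has the two-out-of-three property; (CM2) the three classes are closed under retracts; (CM3) every commutative square from $i$ to $p$ with $i\in\mathrm{TCoFib}$, $p\in\mathrm{Fib}$ or $i\in\mathrm{CoFib}$,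 $p\in\mathrm{TFib}$ has a lifting; (CM4) every morphism factors as $p\circ i$ with $i\in\mathrm{TCoFib}$, $p\in\mathrm{Fib}$ and as $q\circ j$ with $j\in\mathrm{CoFib}$, $q\in\mathrm{TFib}$. No limits or colimits are assumed. It is orthogonal if the liftings in (CM3) are unique. A torsion model structure is an orthogonal model structure such that $\mathrm{CoFib}$ and $\mathrm{Fib}$ have the two-out-of-three property. The homotopy category is $\mathcal A[\mathrm{Weq}^{-1}]$. For an orthogonal model structure (no initial/terminal object needed), $C$ is cofibrant if for every $p:X\to Y$ in $\mathrm{TFib}$ and $u:C\to Y$ there is a unique $v:C\to X$ with $p\circ v=u$; $F$ is fibrant if for every $i:X\to Y$ in $\mathrm{TCoFib}$ and $u:X\to F$ there is a unique $v:Y\to F$ with $v\circ i=u$. A bi-reflective model structure is an orthogonal model structure such that: (M1) for every object $A$ there is a morphism $C\to A$ in $\mathrm{TFib}$ with $C$ cofibrant and a morphism $A\to F$ in $\mathrm{TCoFib}$ with $F$ fibrant; (M2) $\mathrm{TCoFib}$ and $\mathrm{TFib}$ have the two-out-of-three property; (M3) for every $p:C\to D$ in $\mathrm{TFib}$ with $C$ cofibrant and every $u:C\to E$ in $\mathrm{CoFib}$, the pushout of $p$ along $u$ exists and the coprojection $E\to Q$ is in $\mathrm{TFib}$; (M3') for every $i:X\to Z$ in $\mathrm{TCoFib}$ with $Z$ fibrant and every $v:Y\to Z$ in $\mathrm{Fib}$, the pullback of $i$ along $v$ exists and the projection $P'\to Y$ is in $\mathrm{TCoFib}$.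
   Formalization: When m = n, it is additionally assumed that m does not lie strictly between two elements of P; otherwise, for a < m < c, the arrows a→m and m→c are weak equivalences but their composite a→c is not, so two-out-of-three fails and the claim is false. *)

theory Defs
  imports Main
begin

record ('o, 'a) cat =
  Obj :: "'o set"
  Arr :: "'a set"
  Dom :: "'a \<Rightarrow> 'o"
  Cod :: "'a \<Rightarrow> 'o"
  Id :: "'o \<Rightarrow> 'a"
  Comp :: "'a \<Rightarrow> 'a \<Rightarrow> 'a"  \<comment> \<open>\<open>Comp C g f\<close> is \<open>g \<circ> f\<close>, meaningful only if \<open>Cod C f = Dom C g\<close>\<close>

definition Hom :: "('o, 'a) cat \<Rightarrow> 'o \<Rightarrow> 'o \<Rightarrow> 'a set" where
  "Hom C x y = {f \<in> Arr C. Dom C f = x \<and> Cod C f = y}"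

locale category =
  fixes C :: "('o, 'a) cat"
  assumes Dom_in: "f \<in> Arr C \<Longrightarrow> Dom C f \<in> Obj C"
    and Cod_in: "f \<in> Arr C \<Longrightarrow> Cod C f \<in> Obj C"
    and Id_in: "x \<in> Obj C \<Longrightarrow> Id C x \<in> Hom C x x"
    and Comp_in: "f \<in> Hom C x y \<Longrightarrow> g \<in> Hom C y z \<Longrightarrow> Comp C g f \<in> Hom C x z"
    and Id_left: "f \<in> Hom C x y \<Longrightarrow> Comp C (Id C y) f = f"
    and Id_right: "f \<in> Hom C x y \<Longrightarrow> Comp C f (Id C x) = f"
    and Comp_assoc: "f \<in> Hom C w x \<Longrightarrow> g \<in> Hom C x y \<Longrightarrow> h \<in> Hom C y z \<Longrightarrow>
      Comp C h (Comp C g f) = Comp C (Comp C h g) f"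

definition is_iso :: "('o, 'a) cat \<Rightarrow> 'a \<Rightarrow> bool" where
  "is_iso C f \<longleftrightarrow> f \<in> Arr C \<and>
     (\<exists>g \<in> Hom C (Cod C f) (Dom C f).
        Comp C g f = Id C (Dom C f) \<and> Comp C f g = Id C (Cod C f))"

definition is_functor ::
  "('o, 'a) cat \<Rightarrow> ('p, 'b) cat \<Rightarrow> ('o \<Rightarrow> 'p) \<Rightarrow> ('a \<Rightarrow> 'b) \<Rightarrow> bool" where
  "is_functor C D Fo Fa \<longleftrightarrow> category C \<and> category D \<and>
     (\<forall>x \<in> Obj C. Fo x \<in> Obj D) \<and>
     (\<forall>f \<in> Arr C. Fa f \<in> Hom D (Fo (Dom C f)) (Fo (Cod C f))) \<and>
     (\<forall>x \<in> Obj C. Fa (Id C x) = Id D (Fo x)) \<and>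
     (\<forall>f \<in> Arr C. \<forall>g \<in> Arr C. Cod C f = Dom C g \<longrightarrow> Fa (Comp C g f) = Comp D (Fa g) (Fa f))"

definition naturally_isomorphic ::
  "('o, 'a) cat \<Rightarrow> ('p, 'b) cat \<Rightarrow> ('o \<Rightarrow> 'p) \<Rightarrow> ('a \<Rightarrow> 'b) \<Rightarrow> ('o \<Rightarrow> 'p) \<Rightarrow> ('a \<Rightarrow> 'b) \<Rightarrow> bool" where
  "naturally_isomorphic C D Fo Fa Go Ga \<longleftrightarrow>
     is_functor C D Fo Fa \<and> is_functor C D Go Ga \<and>
     (\<exists>\<eta>. (\<forall>x \<in> Obj C. \<eta> x \<in> Hom D (Fo x) (Go x) \<and> is_iso D (\<eta> x)) \<and>
          (\<forall>f \<in> Arr C. Comp D (\<eta> (Cod C f)) (Fa f) = Comp D (Ga f) (\<eta> (Dom C f))))"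

definition equivalent_categories :: "('o, 'a) cat \<Rightarrow> ('p, 'b) cat \<Rightarrow> bool" where
  "equivalent_categories C D \<longleftrightarrow>
     (\<exists>Fo Fa Go Ga. is_functor C D Fo Fa \<and> is_functor D C Go Ga \<and>
        naturally_isomorphic C C (Go \<circ> Fo) (Ga \<circ> Fa) (\<lambda>x. x) (\<lambda>f. f) \<and>
        naturally_isomorphic D D (Fo \<circ> Go) (Fa \<circ> Ga) (\<lambda>x. x) (\<lambda>f. f))"

text \<open>
  The localization has the same objects; its morphisms are zigzags of arrows of \<open>C\<close> and
  formal inverses of arrows in \<open>W\<close>, modulo the congruence generated by the relations of \<open>C\<close>
  and by the requirement that \<open>Bwd w\<close> is inverse to \<open>Fwd w\<close>. Zigzags are read in diagrammatic
  order. A morphism is stored with its end points, since an equivalence class of words does not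
  determine them (for the empty word).
\<close>

datatype 'a zstep = Fwd 'a | Bwd 'a

fun zigzag :: "('o, 'a) cat \<Rightarrow> 'a set \<Rightarrow> 'o \<Rightarrow> 'a zstep list \<Rightarrow> 'o \<Rightarrow> bool" where
  "zigzag C W x [] y \<longleftrightarrow> x \<in> Obj C \<and> x = y"
| "zigzag C W x (Fwd f # us) y \<longleftrightarrow> f \<in> Arr C \<and> Dom C f = x \<and> zigzag C W (Cod C f) us y"
| "zigzag C W x (Bwd w # us) y \<longleftrightarrow> w \<in> Arr C \<inter> W \<and> Cod C w = x \<and> zigzag C W (Dom C w) us y"

inductive zeq :: "('o, 'a) cat \<Rightarrow> 'a set \<Rightarrow> 'o \<Rightarrow> 'a zstep list \<Rightarrow> 'a zstep list \<Rightarrow> 'o \<Rightarrow> bool"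
  for C W where
  zeq_refl: "zigzag C W x us y \<Longrightarrow> zeq C W x us us y"
| zeq_sym: "zeq C W x us vs y \<Longrightarrow> zeq C W x vs us y"
| zeq_trans: "zeq C W x us vs y \<Longrightarrow> zeq C W x vs ws y \<Longrightarrow> zeq C W x us ws y"
| zeq_append: "zeq C W x us us' y \<Longrightarrow> zeq C W y vs vs' z \<Longrightarrow> zeq C W x (us @ vs) (us' @ vs') z"
| zeq_Id: "x \<in> Obj C \<Longrightarrow> zeq C W x [Fwd (Id C x)] [] x"
| zeq_Comp: "f \<in> Hom C x y \<Longrightarrow> g \<in> Hom C y z \<Longrightarrow> zeq C W x [Fwd f, Fwd g] [Fwd (Comp C g f)] z"
| zeq_Fwd_Bwd: "w \<in> Hom C x y \<Longrightarrow> w \<in> W \<Longrightarrow> zeq C W x [Fwd w, Bwd w] [] x"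
| zeq_Bwd_Fwd: "w \<in> Hom C x y \<Longrightarrow> w \<in> W \<Longrightarrow> zeq C W y [Bwd w, Fwd w] [] y"

definition zclass :: "('o, 'a) cat \<Rightarrow> 'a set \<Rightarrow> 'o \<Rightarrow> 'a zstep list \<Rightarrow> 'o \<Rightarrow> 'o \<times> 'o \<times> 'a zstep list set" where
  "zclass C W x us y = (x, y, {vs. zeq C W x us vs y})"

definition localization ::
  "('o, 'a) cat \<Rightarrow> 'a set \<Rightarrow> ('o, 'o \<times> 'o \<times> 'a zstep list set) cat" where
  "localization C W =
    \<lparr>Obj = Obj C,
     Arr = {zclass C W x us y | x us y. zigzag C W x us y},
     Dom = (\<lambda>(x, y, A). x),
     Cod = (\<lambda>(x, y, A). y),
     Id = (\<lambda>x. zclass C W x [] x),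
     Comp = (\<lambda>(y', z, B) (x, y, A).
       (x, z, {ws. \<exists>us \<in> A. \<exists>vs \<in> B. zeq C W x (us @ vs) ws z}))\<rparr>"

definition two_out_of_three :: "('o, 'a) cat \<Rightarrow> 'a set \<Rightarrow> bool" where
  "two_out_of_three C S \<longleftrightarrow>
     (\<forall>f \<in> Arr C. \<forall>g \<in> Arr C. Cod C f = Dom C g \<longrightarrow>
        (f \<in> S \<and> g \<in> S \<longrightarrow> Comp C g f \<in> S) \<and>
        (f \<in> S \<and> Comp C g f \<in> S \<longrightarrow> g \<in> S) \<and>
        (g \<in> S \<and> Comp C g f \<in> S \<longrightarrow> f \<in> S))"

definition is_retract_of :: "('o, 'a) cat \<Rightarrow> 'a \<Rightarrow> 'a \<Rightarrow> bool" where
  "is_retract_of C f g \<longleftrightarrow> f \<in> Arr C \<and> g \<in> Arr C \<and>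
     (\<exists>s \<in> Hom C (Dom C f) (Dom C g). \<exists>r \<in> Hom C (Dom C g) (Dom C f).
      \<exists>s' \<in> Hom C (Cod C f) (Cod C g). \<exists>r' \<in> Hom C (Cod C g) (Cod C f).
        Comp C r s = Id C (Dom C f) \<and> Comp C r' s' = Id C (Cod C f) \<and>
        Comp C g s = Comp C s' f \<and> Comp C f r = Comp C r' g)"

definition retract_closed :: "('o, 'a) cat \<Rightarrow> 'a set \<Rightarrow> bool" where
  "retract_closed C S \<longleftrightarrow> (\<forall>f g. g \<in> S \<and> is_retract_of C f g \<longrightarrow> f \<in> S)"

definition comm_square :: "('o, 'a) cat \<Rightarrow> 'a \<Rightarrow> 'a \<Rightarrow> 'a \<Rightarrow> 'a \<Rightarrow> bool" where
  "comm_square C i p u v \<longleftrightarrow> i \<in> Arr C \<and> p \<in> Arr C \<and>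
     u \<in> Hom C (Dom C i) (Dom C p) \<and> v \<in> Hom C (Cod C i) (Cod C p) \<and>
     Comp C p u = Comp C v i"

definition is_lifting :: "('o, 'a) cat \<Rightarrow> 'a \<Rightarrow> 'a \<Rightarrow> 'a \<Rightarrow> 'a \<Rightarrow> 'a \<Rightarrow> bool" where
  "is_lifting C i p u v h \<longleftrightarrow>
     h \<in> Hom C (Cod C i) (Dom C p) \<and> Comp C h i = u \<and> Comp C p h = v"

locale model_structure = category C
  for C :: "('o, 'a) cat" +
  fixes CoFib Fib Weq :: "'a set"
  assumes CoFib_sub: "CoFib \<subseteq> Arr C"
    and Fib_sub: "Fib \<subseteq> Arr C"
    and Weq_sub: "Weq \<subseteq> Arr C"
    and CM1: "two_out_of_three C Weq"
    and CM2: "retract_closed C CoFib" "retract_closed C Fib" "retract_closed C Weq"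
    and CM3: "comm_square C i p u v \<Longrightarrow>
      i \<in> CoFib \<inter> Weq \<and> p \<in> Fib \<or> i \<in> CoFib \<and> p \<in> Fib \<inter> Weq \<Longrightarrow>
      \<exists>h. is_lifting C i p u v h"
    and CM4: "f \<in> Arr C \<Longrightarrow>
      \<exists>i p. i \<in> CoFib \<inter> Weq \<and> p \<in> Fib \<and> Cod C i = Dom C p \<and> f = Comp C p i"
      "f \<in> Arr C \<Longrightarrow>
      \<exists>j q. j \<in> CoFib \<and> q \<in> Fib \<inter> Weq \<and> Cod C j = Dom C q \<and> f = Comp C q j"

locale orthogonal_model_structure = model_structure C CoFib Fib Weq
  for C :: "('o, 'a) cat" and CoFib Fib Weq +
  assumes lifting_unique: "comm_square C i p u v \<Longrightarrow>
      i \<in> CoFib \<inter> Weq \<and> p \<in> Fib \<or> i \<in> CoFib \<and> p \<in> Fib \<inter> Weq \<Longrightarrow>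
      is_lifting C i p u v h \<Longrightarrow> is_lifting C i p u v h' \<Longrightarrow> h = h'"

locale torsion_model_structure = orthogonal_model_structure C CoFib Fib Weq
  for C :: "('o, 'a) cat" and CoFib Fib Weq +
  assumes CoFib_two_out_of_three: "two_out_of_three C CoFib"
    and Fib_two_out_of_three: "two_out_of_three C Fib"

definition cofibrant :: "('o, 'a) cat \<Rightarrow> 'a set \<Rightarrow> 'a set \<Rightarrow> 'a set \<Rightarrow> 'o \<Rightarrow> bool" where
  "cofibrant C CoFib Fib Weq c \<longleftrightarrow> c \<in> Obj C \<and>
     (\<forall>p \<in> Fib \<inter> Weq. \<forall>u \<in> Hom C c (Cod C p).
        \<exists>!v. v \<in> Hom C c (Dom C p) \<and> Comp C p v = u)"

definition fibrant :: "('o, 'a) cat \<Rightarrow> 'a set \<Rightarrow> 'a set \<Rightarrow> 'a set \<Rightarrow> 'o \<Rightarrow> bool" where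
  "fibrant C CoFib Fib Weq d \<longleftrightarrow> d \<in> Obj C \<and>
     (\<forall>i \<in> CoFib \<inter> Weq. \<forall>u \<in> Hom C (Dom C i) d.
        \<exists>!v. v \<in> Hom C (Cod C i) d \<and> Comp C v i = u)"

text \<open>\<open>is_pushout C p u q e\<close>: the span \<open>p : A \<rightarrow> B\<close>, \<open>u : A \<rightarrow> E\<close> is completed to a pushout
  square by \<open>q : B \<rightarrow> Q\<close>, \<open>e : E \<rightarrow> Q\<close>; dually for \<open>is_pullback\<close>, with the projection
  \<open>a\<close> to the domain of \<open>i\<close> and \<open>b\<close> to the domain of \<open>v\<close>.\<close>

definition is_pushout :: "('o, 'a) cat \<Rightarrow> 'a \<Rightarrow> 'a \<Rightarrow> 'a \<Rightarrow> 'a \<Rightarrow> bool" where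
  "is_pushout C p u q e \<longleftrightarrow>
     {p, u, q, e} \<subseteq> Arr C \<and> Dom C p = Dom C u \<and>
     Dom C q = Cod C p \<and> Dom C e = Cod C u \<and> Cod C q = Cod C e \<and>
     Comp C q p = Comp C e u \<and>
     (\<forall>z. \<forall>q' \<in> Hom C (Cod C p) z. \<forall>e' \<in> Hom C (Cod C u) z. Comp C q' p = Comp C e' u \<longrightarrow>
        (\<exists>!h. h \<in> Hom C (Cod C q) z \<and> Comp C h q = q' \<and> Comp C h e = e'))"

definition is_pullback :: "('o, 'a) cat \<Rightarrow> 'a \<Rightarrow> 'a \<Rightarrow> 'a \<Rightarrow> 'a \<Rightarrow> bool" where
  "is_pullback C i v a b \<longleftrightarrow>
     {i, v, a, b} \<subseteq> Arr C \<and> Cod C i = Cod C v \<and>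
     Cod C a = Dom C i \<and> Cod C b = Dom C v \<and> Dom C a = Dom C b \<and>
     Comp C i a = Comp C v b \<and>
     (\<forall>z. \<forall>a' \<in> Hom C z (Dom C i). \<forall>b' \<in> Hom C z (Dom C v). Comp C i a' = Comp C v b' \<longrightarrow>
        (\<exists>!h. h \<in> Hom C z (Dom C a) \<and> Comp C a h = a' \<and> Comp C b h = b'))"

locale bireflective_model_structure = orthogonal_model_structure C CoFib Fib Weq
  for C :: "('o, 'a) cat" and CoFib Fib Weq +
  assumes M1: "x \<in> Obj C \<Longrightarrow>
      \<exists>p \<in> Fib \<inter> Weq. Cod C p = x \<and> cofibrant C CoFib Fib Weq (Dom C p)"
      "x \<in> Obj C \<Longrightarrow>
      \<exists>i \<in> CoFib \<inter> Weq. Dom C i = x \<and> fibrant C CoFib Fib Weq (Cod C i)"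
    and M2: "two_out_of_three C (CoFib \<inter> Weq)" "two_out_of_three C (Fib \<inter> Weq)"
    and M3: "p \<in> Fib \<inter> Weq \<Longrightarrow> cofibrant C CoFib Fib Weq (Dom C p) \<Longrightarrow>
      u \<in> CoFib \<Longrightarrow> Dom C u = Dom C p \<Longrightarrow>
      (\<exists>q e. is_pushout C p u q e) \<and> (\<forall>q e. is_pushout C p u q e \<longrightarrow> e \<in> Fib \<inter> Weq)"
    and M3': "i \<in> CoFib \<inter> Weq \<Longrightarrow> fibrant C CoFib Fib Weq (Cod C i) \<Longrightarrow>
      v \<in> Fib \<Longrightarrow> Cod C v = Cod C i \<Longrightarrow>
      (\<exists>a b. is_pullback C i v a b) \<and> (\<forall>a b. is_pullback C i v a b \<longrightarrow> b \<in> CoFib \<inter> Weq)"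

text \<open>The homotopy category depends only on the category and the weak equivalences.\<close>

definition homotopy_category ::
  "('o, 'a) cat \<Rightarrow> 'a set \<Rightarrow> 'a set \<Rightarrow> 'a set \<Rightarrow> ('o, 'o \<times> 'o \<times> 'a zstep list set) cat" where
  "homotopy_category C CoFib Fib Weq = localization C Weq"

text \<open>The subset \<open>S\<close> with the order induced by \<open>r\<close>, as a category.\<close>

definition poset_cat :: "'a set \<Rightarrow> 'a rel \<Rightarrow> ('a, 'a \<times> 'a) cat" where
  "poset_cat S r =
    \<lparr>Obj = S, Arr = r \<inter> S \<times> S, Dom = fst, Cod = snd,
     Id = (\<lambda>x. (x, x)), Comp = (\<lambda>g f. (fst f, snd g))\<rparr>"

definition strict :: "'a rel \<Rightarrow> 'a \<Rightarrow> 'a \<Rightarrow> bool" where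
  "strict r x y \<longleftrightarrow> (x, y) \<in> r \<and> x \<noteq> y"

definition is_cut :: "'a set \<Rightarrow> 'a rel \<Rightarrow> 'a \<Rightarrow> bool" where
  "is_cut P r m \<longleftrightarrow> m \<in> P \<and>
     (\<forall>x \<in> P.
        strict r m x \<and> m \<noteq> x \<and> \<not> strict r x m \<or>
        \<not> strict r m x \<and> m = x \<and> \<not> strict r x m \<or>
        \<not> strict r m x \<and> m \<noteq> x \<and> strict r x m)"

definition below_class :: "'a set \<Rightarrow> 'a rel \<Rightarrow> 'a \<Rightarrow> ('a \<times> 'a) set" where
  "below_class P r p = {(a, b) \<in> Arr (poset_cat P r). (b, p) \<in> r} \<union> {Id (poset_cat P r) x | x. x \<in> P}"

definition above_class :: "'a set \<Rightarrow> 'a rel \<Rightarrow> 'a \<Rightarrow> ('a \<times> 'a) set" where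
  "above_class P r p = {(a, b) \<in> Arr (poset_cat P r). (p, a) \<in> r} \<union> {Id (poset_cat P r) x | x. x \<in> P}"

text \<open>
  If \<open>a < m < c\<close>, then for \<open>n = m\<close> the arrows \<open>a \<rightarrow> m\<close> and \<open>m \<rightarrow> c\<close> lie in
  \<open>below_class P r m \<union> above_class P r m\<close> but their composite does not, so this class is
  not closed under composition and cannot be a class of weak equivalences.
\<close>

lemma no_model_structure_at_inner_cut:
  assumes po: "partial_order_on P r" and P: "a \<in> P" "m \<in> P" "c \<in> P"
    and lt: "strict r a m" "strict r m c"
  shows "\<not> model_structure (poset_cat P r) (below_class P r m) (above_class P r m)
           (below_class P r m \<union> above_class P r m)"
proof
  assume "model_structure (poset_cat P r) (below_class P r m) (above_class P r m)
           (below_class P r m \<union> above_class P r m)"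
  then have *: "two_out_of_three (poset_cat P r) (below_class P r m \<union> above_class P r m)"
    by (rule model_structure.CM1)
  have r: "refl_on P r" "antisym r" "trans r"
    using po by (auto simp: partial_order_on_def preorder_on_def)
  have mm: "(m, m) \<in> r" using r P by (auto dest: refl_onD)
  have "(a, m) \<in> below_class P r m" "(m, c) \<in> above_class P r m"
    using lt P mm by (auto simp: below_class_def above_class_def poset_cat_def strict_def)
  moreover have "(a, c) \<in> r" using lt r(3) by (auto simp: strict_def dest: transD)
  ultimately have "(a, c) \<in> below_class P r m \<union> above_class P r m"
    using *[unfolded two_out_of_three_def, rule_format, of "(a, m)" "(m, c)"] lt P
    by (simp add: poset_cat_def strict_def)
  then show False
    using lt r(2) by (auto simp: below_class_def above_class_def poset_cat_def strict_def dest: antisymD)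
qed

end

theory Submission
  imports Defs
begin

text \<open>
  For a cut \<open>p\<close> the pair \<open>(L\<^sub>p, R\<^sub>p)\<close> is an orthogonal factorization system, an arrow from
  below \<open>p\<close> to above \<open>p\<close> factoring through \<open>p\<close>; since \<open>m \<le> n\<close>, the pairs (trivial cofibrations,
  fibrations) and (cofibrations, trivial fibrations) are those of \<open>m\<close> and \<open>n\<close>.
  The spans in (M3) and cospans in (M3') always have an identity leg, so the required pushouts and
  pullbacks are trivial. Clamping to \<open>[m, n]\<close> is functorial, collapses weak equivalences, and comes
  with invertible zigzags from \<open>x\<close> to \<open>clamp x\<close> that are natural in \<open>x\<close>. Hence every zigzag from
  \<open>x\<close> to \<open>y\<close> equals the one through \<open>clamp x \<le> clamp y\<close>, so the localization is thin, and an
  equivalence of thin categories is only a matter of which hom-sets are nonempty.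
\<close>

section \<open>Localizations\<close>

lemma zigzag_obj: "category C \<Longrightarrow> zigzag C W x us y \<Longrightarrow> x \<in> Obj C \<and> y \<in> Obj C"
  by (induction C W x us y rule: zigzag.induct) (auto intro: category.Dom_in category.Cod_in)

lemma zigzag_append:
  "zigzag C W x us y \<Longrightarrow> zigzag C W y vs z \<Longrightarrow> zigzag C W x (us @ vs) z"
  by (induction C W x us y rule: zigzag.induct) auto

declare zeq_trans [trans]

text \<open>\<open>zeq\<close> is reflexive only on zigzags, hence the premise: it puts
  \<open>us\<close> into its own class.\<close>

lemma zclass_eq_iff:
  assumes "zigzag C W x us y"
  shows "zclass C W x us y = zclass C W x vs y \<longleftrightarrow> zeq C W x us vs y"
proof
  assume eq: "zclass C W x us y = zclass C W x vs y"
  have "us \<in> {ws. zeq C W x us ws y}" using zeq_refl[OF assms] by simp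
  then have "zeq C W x vs us y" using eq unfolding zclass_def by blast
  then show "zeq C W x us vs y" by (rule zeq_sym)
next
  assume "zeq C W x us vs y"
  then show "zclass C W x us y = zclass C W x vs y"
    unfolding zclass_def by (blast intro: zeq_sym zeq_trans)
qed

text \<open>Composition is defined through all pairs of representatives. Since \<open>zeq\<close> is
  a congruence for \<open>@\<close>, one pair determines the result.\<close>

lemma Comp_zclass:
  assumes "zigzag C W x us y" "zigzag C W y vs z"
  shows "Comp (localization C W) (zclass C W y vs z) (zclass C W x us y) = zclass C W x (us @ vs) z"
proof -
  have "(\<exists>us' vs'. zeq C W x us us' y \<and> zeq C W y vs vs' z \<and> zeq C W x (us' @ vs') ws z)
      \<longleftrightarrow> zeq C W x (us @ vs) ws z" for ws
    using assms by (blast intro: zeq_refl zeq_append zeq_trans)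
  then show ?thesis by (simp add: localization_def zclass_def Bex_def)
qed

lemma Hom_localization:
  "Hom (localization C W) x y = {zclass C W x us y | us. zigzag C W x us y}"
  by (auto simp: Hom_def localization_def zclass_def)

text \<open>By \<open>Comp_zclass\<close> the unit and associativity laws are inherited from list
  concatenation.\<close>

lemma category_localization:
  assumes "category C"
  shows "category (localization C W)"
proof
  fix f assume "f \<in> Arr (localization C W)"
  then obtain x us y where "f = zclass C W x us y" "zigzag C W x us y"
    by (auto simp: localization_def)
  then show "Dom (localization C W) f \<in> Obj (localization C W)"
    "Cod (localization C W) f \<in> Obj (localization C W)"
    using zigzag_obj[OF assms] by (auto simp: localization_def zclass_def)
next
  fix x assume "x \<in> Obj (localization C W)"
  then have "zigzag C W x [] x" by (simp add: localization_def)
  then show "Id (localization C W) x \<in> Hom (localization C W) x x"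
    unfolding Hom_localization by (force simp: localization_def)
next
  fix f g x y z
  assume "f \<in> Hom (localization C W) x y" "g \<in> Hom (localization C W) y z"
  then show "Comp (localization C W) g f \<in> Hom (localization C W) x z"
    unfolding Hom_localization by (auto simp: Comp_zclass intro: zigzag_append)
next
  fix f x y assume "f \<in> Hom (localization C W) x y"
  then obtain us where us: "f = zclass C W x us y" "zigzag C W x us y"
    unfolding Hom_localization by auto
  have "zigzag C W x [] x" "zigzag C W y [] y"
    using zigzag_obj[OF assms us(2)] by auto
  moreover have "Id (localization C W) u = zclass C W u [] u" for u
    by (simp add: localization_def)
  ultimately show "Comp (localization C W) (Id (localization C W) y) f = f"
    "Comp (localization C W) f (Id (localization C W) x) = f"
    using us by (simp_all add: Comp_zclass)
next
  fix f g h w x y z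
  assume "f \<in> Hom (localization C W) w x" "g \<in> Hom (localization C W) x y"
    "h \<in> Hom (localization C W) y z"
  then show "Comp (localization C W) h (Comp (localization C W) g f)
      = Comp (localization C W) (Comp (localization C W) h g) f"
    unfolding Hom_localization by (auto simp: Comp_zclass zigzag_append)
qed

section \<open>Thin categories\<close>

definition thin :: "('o, 'a) cat \<Rightarrow> bool" where
  "thin C \<longleftrightarrow> (\<forall>x y. \<forall>f \<in> Hom C x y. \<forall>g \<in> Hom C x y. f = g)"

lemma thinD: "thin C \<Longrightarrow> f \<in> Hom C x y \<Longrightarrow> g \<in> Hom C x y \<Longrightarrow> f = g"
  unfolding thin_def by blast

text \<open>The equations for identities and composites compare parallel arrows, so thinness of
  \<open>D\<close> gives them.\<close>

lemma is_functor_thin: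
  assumes "category C" "category D" "thin D"
    and obj: "\<And>x. x \<in> Obj C \<Longrightarrow> Fo x \<in> Obj D"
    and arr: "\<And>f. f \<in> Arr C \<Longrightarrow> Fa f \<in> Hom D (Fo (Dom C f)) (Fo (Cod C f))"
  shows "is_functor C D Fo Fa"
  unfolding is_functor_def
proof (intro conjI ballI impI)
  interpret C: category C by fact
  interpret D: category D by fact
  have hom: "Fa f \<in> Hom D (Fo x) (Fo y)" if "f \<in> Hom C x y" for f x y
    using arr that by (auto simp: Hom_def)
  show "Fa (Id C x) = Id D (Fo x)" if "x \<in> Obj C" for x
    using thinD[OF \<open>thin D\<close>] hom C.Id_in D.Id_in obj that by metis
  show "Fa (Comp C g f) = Comp D (Fa g) (Fa f)"
    if "f \<in> Arr C" "g \<in> Arr C" "Cod C f = Dom C g" for f g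
  proof -
    have fg: "f \<in> Hom C (Dom C f) (Cod C f)" "g \<in> Hom C (Cod C f) (Cod C g)"
      using that by (auto simp: Hom_def)
    show ?thesis
      by (rule thinD[OF \<open>thin D\<close> hom[OF C.Comp_in[OF fg]] D.Comp_in[OF hom[OF fg(1)] hom[OF fg(2)]]])
  qed
qed (use assms in auto)

text \<open>Any arrow back is an inverse, since both composites are endomorphisms and hence
  identities.\<close>

lemma is_iso_thin:
  assumes "category C" "thin C" "f \<in> Hom C x y" "g \<in> Hom C y x"
  shows "is_iso C f"
proof -
  interpret category C by fact
  have "x \<in> Obj C" "y \<in> Obj C" using assms Dom_in Cod_in by (auto simp: Hom_def)
  then have "Comp C g f = Id C x" "Comp C f g = Id C y"
    using thinD[OF assms(2)] assms(3,4) Comp_in Id_in by metis+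
  with assms(3,4) show ?thesis by (auto simp: is_iso_def Hom_def)
qed

text \<open>Arbitrary components serve: naturality squares commute by thinness, and the arrows back
  make the components invertible.\<close>

lemma naturally_isomorphic_thin:
  assumes "is_functor C D Fo Fa" "is_functor C D Go Ga" "thin D"
    and "\<And>x. x \<in> Obj C \<Longrightarrow> Hom D (Fo x) (Go x) \<noteq> {}"
    and "\<And>x. x \<in> Obj C \<Longrightarrow> Hom D (Go x) (Fo x) \<noteq> {}"
  shows "naturally_isomorphic C D Fo Fa Go Ga"
proof -
  interpret C: category C using assms(1) by (simp add: is_functor_def)
  interpret D: category D using assms(1) by (simp add: is_functor_def)
  have "\<forall>x \<in> Obj C. \<exists>e. e \<in> Hom D (Fo x) (Go x)"
    using assms(4) by blast
  then obtain \<eta> where \<eta>: "\<And>x. x \<in> Obj C \<Longrightarrow> \<eta> x \<in> Hom D (Fo x) (Go x)"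
    by metis
  have "is_iso D (\<eta> x)" if "x \<in> Obj C" for x
    using is_iso_thin[OF D.category_axioms assms(3) \<eta>[OF that]] assms(5)[OF that] by blast
  moreover have "Comp D (\<eta> (Cod C f)) (Fa f) = Comp D (Ga f) (\<eta> (Dom C f))" if "f \<in> Arr C" for f
  proof -
    have "Fa f \<in> Hom D (Fo (Dom C f)) (Fo (Cod C f))" "Ga f \<in> Hom D (Go (Dom C f)) (Go (Cod C f))"
      using assms(1,2) that by (auto simp: is_functor_def)
    then show ?thesis
      using \<eta>[OF C.Dom_in[OF that]] \<eta>[OF C.Cod_in[OF that]]
      by (intro thinD[OF assms(3)] D.Comp_in)
  qed
  ultimately show ?thesis
    using assms(1,2) \<eta> unfolding naturally_isomorphic_def by blast
qed

text \<open>Everything is built from the two object maps; the arrow maps are arbitrary choices from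
  hom-sets known to be nonempty.\<close>

lemma equivalent_categories_thin:
  assumes "category C" "category D" "thin C" "thin D"
    and Fo: "\<And>x. x \<in> Obj C \<Longrightarrow> Fo x \<in> Obj D"
    and Go: "\<And>y. y \<in> Obj D \<Longrightarrow> Go y \<in> Obj C"
    and Fa: "\<And>x x'. Hom C x x' \<noteq> {} \<Longrightarrow> Hom D (Fo x) (Fo x') \<noteq> {}"
    and Ga: "\<And>y y'. Hom D y y' \<noteq> {} \<Longrightarrow> Hom C (Go y) (Go y') \<noteq> {}"
    and GF: "\<And>x. x \<in> Obj C \<Longrightarrow> Hom C (Go (Fo x)) x \<noteq> {} \<and> Hom C x (Go (Fo x)) \<noteq> {}"
    and FG: "\<And>y. y \<in> Obj D \<Longrightarrow> Hom D (Fo (Go y)) y \<noteq> {} \<and> Hom D y (Fo (Go y)) \<noteq> {}"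
  shows "equivalent_categories C D"
proof -
  have "\<forall>f \<in> Arr C. \<exists>g. g \<in> Hom D (Fo (Dom C f)) (Fo (Cod C f))"
    using Fa by (force simp: Hom_def)
  then obtain fa where fa: "\<And>f. f \<in> Arr C \<Longrightarrow> fa f \<in> Hom D (Fo (Dom C f)) (Fo (Cod C f))"
    by metis
  have "\<forall>f \<in> Arr D. \<exists>g. g \<in> Hom C (Go (Dom D f)) (Go (Cod D f))"
    using Ga by (force simp: Hom_def)
  then obtain ga where ga: "\<And>f. f \<in> Arr D \<Longrightarrow> ga f \<in> Hom C (Go (Dom D f)) (Go (Cod D f))"
    by metis
  note C = assms(1,3) and D = assms(2,4)
  have F: "is_functor C D Fo fa" by (intro is_functor_thin assms fa)
  have G: "is_functor D C Go ga" by (intro is_functor_thin assms ga)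
  have FG': "is_functor D D (Fo \<circ> Go) (fa \<circ> ga)" and GF': "is_functor C C (Go \<circ> Fo) (ga \<circ> fa)"
    using fa ga Fo Go by (auto intro!: is_functor_thin assms simp: Hom_def)
  have I: "is_functor C C (\<lambda>x. x) (\<lambda>f. f)" "is_functor D D (\<lambda>x. x) (\<lambda>f. f)"
    using C D by (auto intro!: is_functor_thin simp: Hom_def)
  have "naturally_isomorphic C C (Go \<circ> Fo) (ga \<circ> fa) (\<lambda>x. x) (\<lambda>f. f)"
    using GF by (intro naturally_isomorphic_thin GF' I C) auto
  moreover have "naturally_isomorphic D D (Fo \<circ> Go) (fa \<circ> ga) (\<lambda>x. x) (\<lambda>f. f)"
    using FG by (intro naturally_isomorphic_thin FG' I D) auto
  ultimately show ?thesis using F G unfolding equivalent_categories_def by blast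
qed

section \<open>Posets and cuts\<close>

lemma poset_cat_simps [simp]:
  "Obj (poset_cat S r) = S" "Arr (poset_cat S r) = r \<inter> S \<times> S"
  "Dom (poset_cat S r) f = fst f" "Cod (poset_cat S r) f = snd f"
  "Id (poset_cat S r) x = (x, x)" "Comp (poset_cat S r) g f = (fst f, snd g)"
  by (simp_all add: poset_cat_def)

lemma Hom_poset_cat [simp]:
  "f \<in> Hom (poset_cat S r) x y \<longleftrightarrow> f = (x, y) \<and> (x, y) \<in> r \<and> x \<in> S \<and> y \<in> S"
  by (cases f) (auto simp: Hom_def)

lemma thin_poset_cat: "thin (poset_cat S r)"
  by (simp add: thin_def)

locale poset =
  fixes P :: "'a set" and r :: "'a rel"
  assumes po: "partial_order_on P r"
begin

lemma r_subset: "r \<subseteq> P \<times> P" and r_refl: "x \<in> P \<Longrightarrow> (x, x) \<in> r"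
  and r_trans: "(x, y) \<in> r \<Longrightarrow> (y, z) \<in> r \<Longrightarrow> (x, z) \<in> r"
  and r_antisym: "(x, y) \<in> r \<Longrightarrow> (y, x) \<in> r \<Longrightarrow> x = y"
  using po by (auto simp: partial_order_on_def preorder_on_def refl_on_def dest: transD antisymD)

lemma r_in: "(x, y) \<in> r \<Longrightarrow> x \<in> P \<and> y \<in> P"
  using r_subset by blast

lemma Arr_poset [simp]: "r \<inter> P \<times> P = r"
  using r_subset by blast

lemma category_poset_cat: "S \<subseteq> P \<Longrightarrow> category (poset_cat S r)"
  using r_trans by unfold_locales (auto intro: r_refl)

lemma below_iff [simp]: "(a, b) \<in> below_class P r p \<longleftrightarrow> (a, b) \<in> r \<and> ((b, p) \<in> r \<or> a = b)"
  unfolding below_class_def using r_refl r_in by auto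

lemma above_iff [simp]: "(a, b) \<in> above_class P r p \<longleftrightarrow> (a, b) \<in> r \<and> ((p, a) \<in> r \<or> a = b)"
  unfolding above_class_def using r_refl r_in by auto

text \<open>Commutativity and uniqueness are automatic between parallel arrows; what remains is that
  the vertex \<open>d\<close> is the join of \<open>b\<close> and \<open>c\<close>.\<close>

lemma is_pushout_poset_iff:
  "is_pushout (poset_cat P r) (a, b) (a', c) q e \<longleftrightarrow> a = a' \<and> (a, b) \<in> r \<and> (a, c) \<in> r \<and>
    (\<exists>d. q = (b, d) \<and> e = (c, d) \<and> (b, d) \<in> r \<and> (c, d) \<in> r \<and>
      (\<forall>z. (b, z) \<in> r \<longrightarrow> (c, z) \<in> r \<longrightarrow> (d, z) \<in> r))"
proof -
  \<comment> \<open>Hom-sets as explicit singletons or empty sets let the bounded quantifiers of the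
    definition be evaluated.\<close>
  have "Hom (poset_cat P r) x y = (if (x, y) \<in> r then {(x, y)} else {})" for x y
    using r_in by auto
  then show ?thesis
    unfolding is_pushout_def by (cases q; cases e) (auto split: if_splits)
qed

text \<open>Dually, the vertex \<open>d\<close> is the meet of \<open>a\<close> and
  \<open>c\<close>.\<close>

lemma is_pullback_poset_iff:
  "is_pullback (poset_cat P r) (a, b) (c, b') p q \<longleftrightarrow> b = b' \<and> (a, b) \<in> r \<and> (c, b) \<in> r \<and>
    (\<exists>d. p = (d, a) \<and> q = (d, c) \<and> (d, a) \<in> r \<and> (d, c) \<in> r \<and>
      (\<forall>z. (z, a) \<in> r \<longrightarrow> (z, c) \<in> r \<longrightarrow> (z, d) \<in> r))"
proof -
  have "Hom (poset_cat P r) x y = (if (x, y) \<in> r then {(x, y)} else {})" for x y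
    using r_in by auto
  then show ?thesis
    unfolding is_pullback_def by (cases p; cases q) (auto split: if_splits)
qed

section \<open>Retracts, two-out-of-three, liftings and factorizations at a single cut\<close>

lemma retract_poset:
  assumes "is_retract_of (poset_cat P r) f g"
  shows "f = g"
proof -
  have "(fst f, fst g) \<in> r" "(fst g, fst f) \<in> r" "(snd f, snd g) \<in> r" "(snd g, snd f) \<in> r"
    using assms unfolding is_retract_of_def by auto
  then show ?thesis using r_antisym by (simp add: prod_eq_iff)
qed

text \<open>Section and retraction are opposite inequalities, so by antisymmetry a retract is the
  arrow itself and any class qualifies.\<close>

lemma retract_closed_poset: "retract_closed (poset_cat P r) S"
  unfolding retract_closed_def using retract_poset by blast

lemma two_out_of_three_posetI:
  assumes "\<And>a b c. (a, b) \<in> r \<Longrightarrow> (b, c) \<in> r \<Longrightarrow> (a, c) \<in> r \<Longrightarrow>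
      ((a, b) \<in> S \<and> (b, c) \<in> S \<longrightarrow> (a, c) \<in> S) \<and>
      ((a, b) \<in> S \<and> (a, c) \<in> S \<longrightarrow> (b, c) \<in> S) \<and>
      ((b, c) \<in> S \<and> (a, c) \<in> S \<longrightarrow> (a, b) \<in> S)"
  shows "two_out_of_three (poset_cat P r) S"
  unfolding two_out_of_three_def poset_cat_simps Arr_poset
proof (intro ballI impI)
  fix f g assume "f \<in> r" "g \<in> r" "snd f = fst g"
  moreover from this obtain a b c where fg: "f = (a, b)" "g = (b, c)"
    by (metis prod.collapse)
  ultimately have "(a, b) \<in> r" "(b, c) \<in> r" by auto
  with assms[of a b c] r_trans[of a b c]
  show "(f \<in> S \<and> g \<in> S \<longrightarrow> (fst f, snd g) \<in> S) \<and>
      (f \<in> S \<and> (fst f, snd g) \<in> S \<longrightarrow> g \<in> S) \<and>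
      (g \<in> S \<and> (fst f, snd g) \<in> S \<longrightarrow> f \<in> S)"
    unfolding fg fst_conv snd_conv by blast
qed

lemma two_out_of_three_below: "two_out_of_three (poset_cat P r) (below_class P r p)"
  by (rule two_out_of_three_posetI) (metis below_iff r_trans)

lemma two_out_of_three_above: "two_out_of_three (poset_cat P r) (above_class P r p)"
  by (rule two_out_of_three_posetI) (metis above_iff r_trans)

lemma below_above_lifting:
  assumes "comm_square (poset_cat P r) i q u v"
    and "i \<in> below_class P r p" "q \<in> above_class P r p"
  shows "\<exists>!h. is_lifting (poset_cat P r) i q u v h"
proof -
  have uv: "u = (fst i, fst q)" "v = (snd i, snd q)" "(fst i, fst q) \<in> r" "(snd i, snd q) \<in> r"
    using assms(1) unfolding comm_square_def poset_cat_simps Hom_poset_cat by blast+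
  have "(snd i, p) \<in> r \<or> fst i = snd i" "(p, fst q) \<in> r \<or> fst q = snd q"
    using assms(2,3) below_iff[of "fst i" "snd i"] above_iff[of "fst q" "snd q"] by simp_all
  \<comment> \<open>The diagonal is \<open>u\<close> if \<open>i\<close> is an identity,
    \<open>v\<close> if \<open>q\<close> is one, and otherwise passes through
    \<open>p\<close>.\<close>
  then have "(snd i, fst q) \<in> r"
    using uv(3,4) r_trans[of "snd i" p "fst q"] by auto
  then show ?thesis
    using r_in unfolding is_lifting_def uv(1,2) by auto
qed

lemma cut_cases: "is_cut P r p \<Longrightarrow> x \<in> P \<Longrightarrow> (x, p) \<in> r \<or> (p, x) \<in> r"
  unfolding is_cut_def strict_def using r_refl by blast

lemma cut_in: "is_cut P r p \<Longrightarrow> p \<in> P"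
  by (simp add: is_cut_def)

text \<open>Comparability with \<open>p\<close> leaves three positions: an arrow on one side of
  \<open>p\<close> takes an identity as its other factor, and one that crosses factors through
  \<open>p\<close>.\<close>

lemma below_above_factorization:
  assumes "is_cut P r p" "f \<in> r"
  shows "\<exists>i \<in> below_class P r p. \<exists>q \<in> above_class P r p. snd i = fst q \<and> f = (fst i, snd q)"
proof -
  obtain a b where f: "f = (a, b)" by (cases f)
  with assms have ab: "(a, b) \<in> r" "(a, a) \<in> r" "(b, b) \<in> r" "(p, p) \<in> r"
    using r_in r_refl cut_in by blast+
  consider "(b, p) \<in> r" | "(p, a) \<in> r" | "(a, p) \<in> r" "(p, b) \<in> r"
    using cut_cases[OF assms(1)] r_in[OF ab(1)] by blast
  then show ?thesis
  proof cases
    case 1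
    show ?thesis by (rule bexI[of _ "(a, b)"], rule bexI[of _ "(b, b)"]) (use 1 f ab in auto)
  next
    case 2
    show ?thesis by (rule bexI[of _ "(a, a)"], rule bexI[of _ "(a, b)"]) (use 2 f ab in auto)
  next
    case 3
    show ?thesis by (rule bexI[of _ "(a, p)"], rule bexI[of _ "(p, b)"]) (use 3 f ab in auto)
  qed
qed

end

section \<open>The model structure of two cuts\<close>

locale cut_pair = poset P r for P :: "'a set" and r :: "'a rel" +
  fixes m n :: 'a
  assumes cut_m: "is_cut P r m" and cut_n: "is_cut P r n" and m_le_n: "(m, n) \<in> r"
    and not_inner: "m = n \<longrightarrow> \<not> (\<exists>a \<in> P. \<exists>c \<in> P. strict r a m \<and> strict r m c)"
begin

abbreviation "C \<equiv> poset_cat P r"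
abbreviation "CoFib \<equiv> below_class P r n"
abbreviation "Fib \<equiv> above_class P r m"
abbreviation "Weq \<equiv> below_class P r m \<union> above_class P r n"

sublocale category C
  by (rule category_poset_cat) simp

text \<open>An arrow \<open>a \<le> b\<close> of \<open>above_class P r n\<close> with
  \<open>b \<le> n\<close> has \<open>n \<le> a \<le> b \<le> n\<close> and is an identity; the
  class below \<open>m\<close> is contained in the one below \<open>n\<close>.\<close>

lemma TCoFib_eq: "CoFib \<inter> Weq = below_class P r m"
proof -
  have "a = b" if "(a, b) \<in> r" "(n, a) \<in> r" "(b, n) \<in> r" for a b
    using that r_trans r_antisym by metis
  moreover have "(b, n) \<in> r" if "(b, m) \<in> r" for b
    using that m_le_n r_trans by blast
  ultimately show ?thesis by auto
qed

text \<open>Dually, an arrow with source above \<open>m\<close> and target below \<open>m\<close> is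
  an identity.\<close>

lemma TFib_eq: "Fib \<inter> Weq = above_class P r n"
proof -
  have "a = b" if "(a, b) \<in> r" "(m, a) \<in> r" "(b, m) \<in> r" for a b
    using that r_trans r_antisym by metis
  moreover have "(m, a) \<in> r" if "(n, a) \<in> r" for a
    using that m_le_n r_trans by blast
  ultimately show ?thesis by auto
qed

text \<open>The only place where the hypothesis on \<open>m = n\<close> is needed: it rules out \<open>a < m = n < c\<close>.\<close>

lemma below_above_comp:
  assumes "(a, b) \<in> r" "(b, m) \<in> r" "(n, b) \<in> r" "(b, c) \<in> r"
  shows "a = b \<or> b = c"
proof -
  have "(n, m) \<in> r" using assms r_trans by blast
  then have "m = n" using m_le_n r_antisym by blast
  then have "b = m" using assms r_antisym by blast
  then show ?thesis
    using not_inner \<open>m = n\<close> assms(1,4) r_in by (auto simp: strict_def)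
qed

text \<open>Cancellation holds because \<open>c \<le> m\<close> passes to \<open>b\<close>,
  \<open>n \<le> a\<close> passes to \<open>b\<close>, and an identity composite has identity
  factors. Composition is delicate only for an arrow below \<open>m\<close> followed by one above
  \<open>n\<close>, where \<open>below_above_comp\<close> applies.\<close>

lemma two_out_of_three_Weq: "two_out_of_three C Weq"
proof (rule two_out_of_three_posetI)
  fix a b c assume ab: "(a, b) \<in> r" and bc: "(b, c) \<in> r" and ac: "(a, c) \<in> r"
  have Weq_iff: "(x, y) \<in> Weq \<longleftrightarrow> (y, m) \<in> r \<or> (n, x) \<in> r \<or> x = y" if "(x, y) \<in> r" for x y
    using that by auto
  have b_low: "(b, m) \<in> r" if "(c, m) \<in> r" using that bc r_trans by blast
  have b_high: "(n, b) \<in> r" if "(n, a) \<in> r" using that ab r_trans by blast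
  have antisym: "a = b" if "a = c" using that ab bc r_antisym by blast
  note comp = below_above_comp[OF ab _ _ bc]
  show "((a, b) \<in> Weq \<and> (b, c) \<in> Weq \<longrightarrow> (a, c) \<in> Weq) \<and>
      ((a, b) \<in> Weq \<and> (a, c) \<in> Weq \<longrightarrow> (b, c) \<in> Weq) \<and>
      ((b, c) \<in> Weq \<and> (a, c) \<in> Weq \<longrightarrow> (a, b) \<in> Weq)"
    unfolding Weq_iff[OF ab] Weq_iff[OF bc] Weq_iff[OF ac]
    using b_low b_high antisym comp by blast
qed

sublocale model_structure C CoFib Fib Weq
proof
  show "\<exists>h. is_lifting C i p u v h"
    if "comm_square C i p u v" "i \<in> CoFib \<inter> Weq \<and> p \<in> Fib \<or> i \<in> CoFib \<and> p \<in> Fib \<inter> Weq" for i p u v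
    using that below_above_lifting unfolding TCoFib_eq TFib_eq by blast
  show "\<exists>i p. i \<in> CoFib \<inter> Weq \<and> p \<in> Fib \<and> Cod C i = Dom C p \<and> f = Comp C p i"
    if "f \<in> Arr C" for f
    using below_above_factorization[OF cut_m, of f] that unfolding TCoFib_eq by auto
  show "\<exists>j q. j \<in> CoFib \<and> q \<in> Fib \<inter> Weq \<and> Cod C j = Dom C q \<and> f = Comp C q j"
    if "f \<in> Arr C" for f
    using below_above_factorization[OF cut_n, of f] that unfolding TFib_eq by auto
  show "two_out_of_three C Weq" by (rule two_out_of_three_Weq)
  show "retract_closed C CoFib" "retract_closed C Fib" "retract_closed C Weq"
    by (rule retract_closed_poset)+
qed auto

sublocale torsion_model_structure C CoFib Fib Weq
proof
  show "h = h'" if "comm_square C i p u v"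
    "i \<in> CoFib \<inter> Weq \<and> p \<in> Fib \<or> i \<in> CoFib \<and> p \<in> Fib \<inter> Weq"
    "is_lifting C i p u v h" "is_lifting C i p u v h'" for i p u v h h'
    using that below_above_lifting unfolding TCoFib_eq TFib_eq by blast
qed (rule two_out_of_three_below two_out_of_three_above)+

section \<open>Cofibrant and fibrant objects, and the bi-reflective structure\<close>

lemma cofibrant_iff: "cofibrant C CoFib Fib Weq x \<longleftrightarrow> (x, n) \<in> r"
proof
  assume cof: "cofibrant C CoFib Fib Weq x"
  then have x: "x \<in> P" by (simp add: cofibrant_def)
  show "(x, n) \<in> r"
  proof (rule ccontr)
    assume "(x, n) \<notin> r"
    \<comment> \<open>Lifting the identity of \<open>x\<close> along this trivial fibration would
      give \<open>x \<le> n\<close>.\<close>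
    then have "(n, x) \<in> above_class P r n"
      using x cut_cases[OF cut_n] r_refl cut_in[OF cut_n] by auto
    then show False
      using cof \<open>(x, n) \<notin> r\<close> x r_refl unfolding cofibrant_def TFib_eq by fastforce
  qed
next
  assume xn: "(x, n) \<in> r"
  \<comment> \<open>Either \<open>c = d\<close>, or \<open>x \<le> n \<le> c\<close>.\<close>
  have "(x, c) \<in> r" if "(c, d) \<in> above_class P r n" "(x, d) \<in> r" for c d
    using that xn r_trans by (metis above_iff)
  then show "cofibrant C CoFib Fib Weq x"
    unfolding cofibrant_def TFib_eq using r_in[OF xn] r_in by (fastforce simp del: above_iff)
qed

lemma fibrant_iff: "fibrant C CoFib Fib Weq x \<longleftrightarrow> (m, x) \<in> r"
proof
  assume fib: "fibrant C CoFib Fib Weq x"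
  then have x: "x \<in> P" by (simp add: fibrant_def)
  show "(m, x) \<in> r"
  proof (rule ccontr)
    assume "(m, x) \<notin> r"
    \<comment> \<open>Extending the identity of \<open>x\<close> along this trivial cofibration
      would give \<open>m \<le> x\<close>.\<close>
    then have "(x, m) \<in> below_class P r m"
      using x cut_cases[OF cut_m] r_refl cut_in[OF cut_m] by auto
    then show False
      using fib \<open>(m, x) \<notin> r\<close> x r_refl unfolding fibrant_def TCoFib_eq by fastforce
  qed
next
  assume mx: "(m, x) \<in> r"
  have "(d, x) \<in> r" if "(c, d) \<in> below_class P r m" "(c, x) \<in> r" for c d
    using that mx r_trans by (metis below_iff)
  then show "fibrant C CoFib Fib Weq x"
    unfolding fibrant_def TCoFib_eq using r_in[OF mx] r_in by (fastforce simp del: below_iff)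
qed

sublocale bireflective_model_structure C CoFib Fib Weq
proof
  show "\<exists>p \<in> Fib \<inter> Weq. Cod C p = x \<and> cofibrant C CoFib Fib Weq (Dom C p)"
    if "x \<in> Obj C" for x
  proof (cases "(x, n) \<in> r")
    case True
    then show ?thesis
      unfolding TFib_eq cofibrant_iff using that r_refl by (intro bexI[of _ "(x, x)"]) auto
  next
    case False
    then have "(n, x) \<in> r" using that cut_cases[OF cut_n] by auto
    then show ?thesis
      unfolding TFib_eq cofibrant_iff using r_in r_refl by (intro bexI[of _ "(n, x)"]) auto
  qed
  show "\<exists>i \<in> CoFib \<inter> Weq. Dom C i = x \<and> fibrant C CoFib Fib Weq (Cod C i)"
    if "x \<in> Obj C" for x
  proof (cases "(m, x) \<in> r")
    case True
    then show ?thesis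
      unfolding TCoFib_eq fibrant_iff using that r_refl by (intro bexI[of _ "(x, x)"]) auto
  next
    case False
    then have "(x, m) \<in> r" using that cut_cases[OF cut_m] by auto
    then show ?thesis
      unfolding TCoFib_eq fibrant_iff using r_in r_refl by (intro bexI[of _ "(x, m)"]) auto
  qed
  show "two_out_of_three C (CoFib \<inter> Weq)" "two_out_of_three C (Fib \<inter> Weq)"
    unfolding TCoFib_eq TFib_eq by (rule two_out_of_three_below two_out_of_three_above)+
  show "(\<exists>q e. is_pushout C p u q e) \<and> (\<forall>q e. is_pushout C p u q e \<longrightarrow> e \<in> Fib \<inter> Weq)"
    if p: "p \<in> Fib \<inter> Weq" and cof: "cofibrant C CoFib Fib Weq (Dom C p)"
      and u: "u \<in> CoFib" and dom: "Dom C u = Dom C p" for p u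
  proof -
    obtain a b e where pu: "p = (a, b)" "u = (a, e)" using dom by (cases p; cases u) simp
    have r: "(a, b) \<in> r" "(a, e) \<in> r" "(b, b) \<in> r" "(e, e) \<in> r"
      using p u r_in r_refl unfolding pu by auto
    have "a = b \<or> (n, a) \<in> r \<and> (a, n) \<in> r" "(e, n) \<in> r \<or> a = e"
      using p u cof unfolding TFib_eq cofibrant_iff pu by auto
    \<comment> \<open>If \<open>p\<close> is not an identity then \<open>a = n\<close>, and
      \<open>a \<le> e \<le> n\<close> forces \<open>e = a\<close>.\<close>
    then consider "a = b" | "a = e"
      using r_antisym r(2) r_trans by metis
    then show ?thesis
    \<comment> \<open>The coprojection is an identity when \<open>p\<close> is one, and
      \<open>p\<close> itself when \<open>u\<close> is an identity; antisymmetry makes the vertex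
      unique.\<close>
    proof cases
      case 1
      with r show ?thesis
        unfolding pu is_pushout_poset_iff TFib_eq by (blast dest: r_antisym intro: above_iff[THEN iffD2])
    next
      case 2
      with r p show ?thesis
        unfolding pu is_pushout_poset_iff TFib_eq by (blast dest: r_antisym)
    qed
  qed
  show "(\<exists>a b. is_pullback C i v a b) \<and> (\<forall>a b. is_pullback C i v a b \<longrightarrow> b \<in> CoFib \<inter> Weq)"
    if i: "i \<in> CoFib \<inter> Weq" and fib: "fibrant C CoFib Fib Weq (Cod C i)"
      and v: "v \<in> Fib" and cod: "Cod C v = Cod C i" for i v
  proof -
    obtain a b y where iv: "i = (a, b)" "v = (y, b)" using cod by (cases i; cases v) simp
    have r: "(a, b) \<in> r" "(y, b) \<in> r" "(a, a) \<in> r" "(y, y) \<in> r"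
      using i v r_in r_refl unfolding iv by auto
    have "a = b \<or> (m, b) \<in> r \<and> (b, m) \<in> r" "(m, y) \<in> r \<or> y = b"
      using i v fib unfolding TCoFib_eq fibrant_iff iv by auto
    \<comment> \<open>If \<open>i\<close> is not an identity then \<open>b = m\<close>, and
      \<open>m \<le> y \<le> b\<close> forces \<open>y = b\<close>.\<close>
    then consider "a = b" | "y = b"
      using r_antisym r(2) r_trans by metis
    then show ?thesis
    proof cases
      case 1
      with r show ?thesis
        unfolding iv is_pullback_poset_iff TCoFib_eq by (blast dest: r_antisym intro: below_iff[THEN iffD2])
    next
      case 2
      with r i show ?thesis
        unfolding iv is_pullback_poset_iff TCoFib_eq by (blast dest: r_antisym)
    qed
  qed
qed

subsection \<open>The homotopy category\<close>

text \<open>For \<open>x\<close> in \<open>P\<close> the failed tests mean strictly below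
  \<open>m\<close> and strictly above \<open>n\<close>. With this negated form the end points fall
  into the last branch, where \<open>to_clamp\<close> and \<open>from_clamp\<close> are
  empty.\<close>

definition clamp :: "'a \<Rightarrow> 'a" where
  "clamp x = (if (m, x) \<notin> r then m else if (x, n) \<notin> r then n else x)"

lemma clamp_low: "(x, m) \<in> r \<Longrightarrow> clamp x = m"
  using m_le_n by (auto simp: clamp_def dest: r_antisym)

lemma clamp_high: "(n, x) \<in> r \<Longrightarrow> clamp x = n"
  using m_le_n r_trans r_antisym unfolding clamp_def by metis

lemma clamp_mid: "(m, x) \<in> r \<Longrightarrow> (x, n) \<in> r \<Longrightarrow> clamp x = x"
  by (simp add: clamp_def)

text \<open>The cases are disjoint and follow the branches of \<open>clamp\<close>,
  \<open>to_clamp\<close> and \<open>from_clamp\<close>, so each one selects a branch.\<close>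

lemma position_cases:
  assumes "x \<in> P"
  obtains (low) "(x, m) \<in> r" "(m, x) \<notin> r" | (mid) "(m, x) \<in> r" "(x, n) \<in> r"
    | (high) "(m, x) \<in> r" "(n, x) \<in> r" "(x, n) \<notin> r"
  using cut_cases[OF cut_m assms] cut_cases[OF cut_n assms] by blast

lemma clamp_range:
  assumes "x \<in> P"
  shows "(m, clamp x) \<in> r" "(clamp x, n) \<in> r" "clamp x \<in> P"
  using m_le_n r_refl[OF cut_in[OF cut_m]] r_refl[OF cut_in[OF cut_n]] r_in assms
  by (auto simp: clamp_def)

text \<open>The source decides: a low one goes to \<open>m\<close>, the least value; a mid one makes
  \<open>clamp y\<close> either \<open>y\<close> or \<open>n\<close>; a high one forces
  \<open>y\<close> above \<open>n\<close>.\<close>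

lemma clamp_mono:
  assumes "(x, y) \<in> r"
  shows "(clamp x, clamp y) \<in> r"
proof -
  have P: "x \<in> P" "y \<in> P" using assms r_in by auto
  from P(1) show ?thesis
  proof (cases rule: position_cases)
    case low
    then show ?thesis using clamp_low clamp_range[OF P(2)] by simp
  next
    case mid
    then have "(m, y) \<in> r" using assms r_trans by blast
    with mid assms show ?thesis by (simp add: clamp_def)
  next
    case high
    then have "(n, y) \<in> r" using assms r_trans by blast
    with high show ?thesis using clamp_high r_refl[OF cut_in[OF cut_n]] by simp
  qed
qed

text \<open>Unless the arrow is an identity, its ends lie both below \<open>m\<close> or both above
  \<open>n\<close>.\<close>

lemma clamp_Weq: "(x, y) \<in> Weq \<Longrightarrow> clamp x = clamp y"
  using clamp_low clamp_high r_trans by fastforce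

text \<open>For low \<open>x\<close> the arrow to \<open>m\<close>, and for high \<open>x\<close>
  the arrow from \<open>n\<close>, is a weak equivalence, so it may be run in either
  direction.\<close>

definition to_clamp :: "'a \<Rightarrow> ('a \<times> 'a) zstep list" where
  "to_clamp x = (if (m, x) \<notin> r then [Fwd (x, m)] else if (x, n) \<notin> r then [Bwd (n, x)] else [])"

definition from_clamp :: "'a \<Rightarrow> ('a \<times> 'a) zstep list" where
  "from_clamp x = (if (m, x) \<notin> r then [Bwd (x, m)] else if (x, n) \<notin> r then [Fwd (n, x)] else [])"

section \<open>Zigzags between an object and its clamp\<close>

abbreviation "Z \<equiv> zigzag C Weq"
abbreviation "Zeq \<equiv> zeq C Weq"

lemma zigzag_clamp:
  assumes "x \<in> P"
  shows "Z x (to_clamp x) (clamp x)" "Z (clamp x) (from_clamp x) x"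
  using assms(1) by (cases rule: position_cases;
      use assms cut_in[OF cut_m] cut_in[OF cut_n] r_refl in
        \<open>auto simp: to_clamp_def from_clamp_def clamp_def\<close>)+

lemma Zeq_comp: "(x, y) \<in> r \<Longrightarrow> (y, z) \<in> r \<Longrightarrow> Zeq x [Fwd (x, y), Fwd (y, z)] [Fwd (x, z)] z"
  using zeq_Comp[of "(x, y)" C x y "(y, z)" z] r_in by auto

lemma Zeq_id: "x \<in> P \<Longrightarrow> Zeq x [Fwd (x, x)] [] x"
  using zeq_Id[of x C] by simp

lemma Zeq_Fwd_Bwd: "(x, y) \<in> Weq \<Longrightarrow> Zeq x [Fwd (x, y), Bwd (x, y)] [] x"
  using zeq_Fwd_Bwd[of "(x, y)" C x y Weq] r_in by auto

lemma Zeq_Bwd_Fwd: "(x, y) \<in> Weq \<Longrightarrow> Zeq y [Bwd (x, y), Fwd (x, y)] [] y"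
  using zeq_Bwd_Fwd[of "(x, y)" C x y Weq] r_in by auto

text \<open>Permits rewriting in the middle of a zigzag.\<close>

lemma Zeq_context:
  assumes "Zeq x us us' y" "Z w ps x" "Z y qs z"
  shows "Zeq w (ps @ us @ qs) (ps @ us' @ qs) z"
  using assms by (intro zeq_append zeq_refl)

text \<open>Makes \<open>to_clamp x\<close> and \<open>from_clamp x\<close> mutually inverse in the
  localization: outside the interval they run one weak equivalence in opposite directions.\<close>

lemma Zeq_clamp:
  assumes "x \<in> P"
  shows "Zeq x (to_clamp x @ from_clamp x) [] x" "Zeq (clamp x) (from_clamp x @ to_clamp x) [] (clamp x)"
proof -
  have "Zeq x (to_clamp x @ from_clamp x) [] x \<and> Zeq (clamp x) (from_clamp x @ to_clamp x) [] (clamp x)"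
    using assms
  proof (cases rule: position_cases)
    case low
    then have "(x, m) \<in> Weq" using cut_in[OF cut_m] r_refl by auto
    with low Zeq_Fwd_Bwd Zeq_Bwd_Fwd show ?thesis
      by (simp add: to_clamp_def from_clamp_def clamp_def)
  next
    case mid
    then show ?thesis using assms
      by (simp add: to_clamp_def from_clamp_def clamp_def zeq_refl)
  next
    case high
    then have "(n, x) \<in> Weq" using cut_in[OF cut_n] r_refl by auto
    with high Zeq_Fwd_Bwd Zeq_Bwd_Fwd show ?thesis
      by (simp add: to_clamp_def from_clamp_def clamp_def)
  qed
  then show "Zeq x (to_clamp x @ from_clamp x) [] x"
    "Zeq (clamp x) (from_clamp x @ to_clamp x) [] (clamp x)" by auto
qed

text \<open>Naturality of \<open>to_clamp\<close>. If \<open>x \<le> n\<close>, both sides reduce to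
  the single arrow from \<open>x\<close> to \<open>clamp y\<close>; otherwise both reduce to
  \<open>[Bwd (n, x)]\<close>.\<close>

lemma Zeq_natural:
  assumes xy: "(x, y) \<in> r"
  shows "Zeq x (Fwd (x, y) # to_clamp y) (to_clamp x @ [Fwd (clamp x, clamp y)]) (clamp y)"
proof -
  have P: "x \<in> P" "y \<in> P" using xy r_in by auto
  have nn: "n \<in> P" "(n, n) \<in> r" using cut_in[OF cut_n] r_refl by auto
  have mid_or_low: "Zeq x (to_clamp x @ [Fwd (clamp x, z)]) [Fwd (x, z)] z"
    if "(x, n) \<in> r" "(clamp x, z) \<in> r" for z
    using P(1)
  proof (cases rule: position_cases)
    case low
    with that show ?thesis using Zeq_comp[of x m z] by (simp add: to_clamp_def clamp_def)
  next
    case mid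
    with that show ?thesis using r_in by (auto simp: to_clamp_def clamp_def intro!: zeq_refl)
  qed (use that in auto)
  show ?thesis
  proof (cases "(x, n) \<in> r")
    case True
    have "Zeq x (Fwd (x, y) # to_clamp y) [Fwd (x, clamp y)] (clamp y)"
      using P(2)
    proof (cases rule: position_cases)
      case low
      then show ?thesis using Zeq_comp[OF xy, of m] by (simp add: to_clamp_def clamp_def)
    next
      case mid
      then show ?thesis using xy P by (auto simp: to_clamp_def clamp_def intro!: zeq_refl)
    next
      case high
      then have ny: "(n, y) \<in> Weq" using nn by auto
      \<comment> \<open>The arrow to \<open>y\<close> is split at \<open>n\<close> so that its
        second half cancels against \<open>Bwd (n, y)\<close>.\<close>
      have "Zeq x [Fwd (x, y), Bwd (n, y)] [Fwd (x, n), Fwd (n, y), Bwd (n, y)] n"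
        using Zeq_context[OF zeq_sym[OF Zeq_comp[OF True high(2)]], of x "[]" "[Bwd (n, y)]" n] ny P nn
        by auto
      also have "Zeq x [Fwd (x, n), Fwd (n, y), Bwd (n, y)] [Fwd (x, n)] n"
        using Zeq_context[OF Zeq_Fwd_Bwd[OF ny], of x "[Fwd (x, n)]" "[]" n] True P nn by auto
      finally show ?thesis using high by (simp add: to_clamp_def clamp_def)
    qed
    then show ?thesis
      using mid_or_low[OF True clamp_mono[OF xy]] by (blast intro: zeq_sym zeq_trans)
  next
    case False
    then have nx: "(n, x) \<in> r" using P cut_cases[OF cut_n] by blast
    then have ny: "(n, y) \<in> r" and yn: "(y, n) \<notin> r" using xy False r_trans by blast+
    have mx: "(m, x) \<in> r" "(m, y) \<in> r" using nx ny m_le_n r_trans by blast+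
    have W: "(n, x) \<in> Weq" "(n, y) \<in> Weq" using nx ny nn by auto
    \<comment> \<open>Inserting an inverse pair at \<open>x\<close> supplies
      \<open>n \<le> x\<close>, which composes with \<open>x \<le> y\<close> and then
      cancels.\<close>
    have "Zeq x [Fwd (x, y), Bwd (n, y)] [Bwd (n, x), Fwd (n, x), Fwd (x, y), Bwd (n, y)] n"
      using Zeq_context[OF zeq_sym[OF Zeq_Bwd_Fwd[OF W(1)]], of x "[]" "[Fwd (x, y), Bwd (n, y)]" n]
        W xy P nn by auto
    also have "Zeq x [Bwd (n, x), Fwd (n, x), Fwd (x, y), Bwd (n, y)] [Bwd (n, x), Fwd (n, y), Bwd (n, y)] n"
      using Zeq_context[OF Zeq_comp[OF nx xy], of x "[Bwd (n, x)]" "[Bwd (n, y)]" n]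
        W P nn by auto
    also have "Zeq x [Bwd (n, x), Fwd (n, y), Bwd (n, y)] [Bwd (n, x)] n"
      using Zeq_context[OF Zeq_Fwd_Bwd[OF W(2)], of x "[Bwd (n, x)]" "[]" n] W P nn by auto
    \<comment> \<open>The identity of \<open>n\<close> is the arrow between the clamps, both of
      which equal \<open>n\<close>.\<close>
    also have "Zeq x [Bwd (n, x)] [Bwd (n, x), Fwd (n, n)] n"
      using Zeq_context[OF zeq_sym[OF Zeq_id[OF nn(1)]], of x "[Bwd (n, x)]" "[]" n] W P nn by auto
    finally show ?thesis
      using False mx yn by (simp add: to_clamp_def clamp_def)
  qed
qed

section \<open>Normal forms of zigzags, depending only on the end points\<close>

definition normal :: "'a \<Rightarrow> 'a \<Rightarrow> ('a \<times> 'a) zstep list" where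
  "normal x y = to_clamp x @ Fwd (clamp x, clamp y) # from_clamp y"

lemma zigzag_normal:
  assumes "x \<in> P" "y \<in> P" "(clamp x, clamp y) \<in> r"
  shows "Z x (normal x y) y"
  unfolding normal_def using zigzag_clamp assms clamp_range
  by (intro zigzag_append[where y = "clamp x"]) auto

text \<open>The inner \<open>from_clamp y @ to_clamp y\<close> cancels, and the two arrows between
  clamps compose.\<close>

lemma normal_trans:
  assumes "x \<in> P" "y \<in> P" "z \<in> P" "(clamp x, clamp y) \<in> r" "(clamp y, clamp z) \<in> r"
  shows "Zeq x (normal x y @ normal y z) (normal x z) z"
proof -
  let ?p = "to_clamp x @ [Fwd (clamp x, clamp y)]" and ?q = "Fwd (clamp y, clamp z) # from_clamp z"
  have "Z x ?p (clamp y)" "Z (clamp y) ?q z"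
    using zigzag_clamp clamp_range assms by (auto intro!: zigzag_append[where y = "clamp x"])
  from Zeq_context[OF Zeq_clamp(2)[OF assms(2)] this]
  have "Zeq x (normal x y @ normal y z)
      (to_clamp x @ [Fwd (clamp x, clamp y), Fwd (clamp y, clamp z)] @ from_clamp z) z"
    by (simp add: normal_def)
  also have "Zeq x (to_clamp x @ [Fwd (clamp x, clamp y), Fwd (clamp y, clamp z)] @ from_clamp z) (normal x z) z"
    using Zeq_context[OF Zeq_comp[OF assms(4,5)] zigzag_clamp(1) zigzag_clamp(2)] assms
    by (simp add: normal_def)
  finally show ?thesis .
qed

lemma normal_refl:
  assumes "x \<in> P" "y \<in> P" "x = y"
  shows "Zeq x [] (normal x y) y"
proof -
  have "Zeq x (normal x x) (to_clamp x @ from_clamp x) x"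
    using Zeq_context[OF Zeq_id zigzag_clamp] assms clamp_range by (simp add: normal_def)
  then show ?thesis using Zeq_clamp(1) assms by (blast intro: zeq_sym zeq_trans)
qed

text \<open>Append the trivial loop from \<open>y\<close> through \<open>clamp y\<close>, then move
  \<open>to_clamp\<close> across the arrow by naturality.\<close>

lemma Zeq_Fwd_normal:
  assumes "(x, y) \<in> r"
  shows "Zeq x [Fwd (x, y)] (normal x y) y"
proof -
  have P: "x \<in> P" "y \<in> P" using assms r_in by auto
  have "Zeq x [Fwd (x, y)] (Fwd (x, y) # to_clamp y @ from_clamp y) y"
    using Zeq_context[OF zeq_sym[OF Zeq_clamp(1)[OF P(2)]], of x "[Fwd (x, y)]" "[]" y] assms P by auto
  also have "Zeq x (Fwd (x, y) # to_clamp y @ from_clamp y) (normal x y) y"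
    using zeq_append[OF Zeq_natural[OF assms] zeq_refl[OF zigzag_clamp(2)[OF P(2)]]]
    by (simp add: normal_def)
  finally show ?thesis .
qed

text \<open>Uniqueness of inverses: the clamps coincide, so \<open>normal y x\<close> is a right
  inverse of \<open>normal x y\<close>, hence of \<open>Fwd (x, y)\<close>, and therefore equals
  \<open>Bwd (x, y)\<close>.\<close>

lemma Zeq_Bwd_normal:
  assumes "(x, y) \<in> Weq"
  shows "Zeq y [Bwd (x, y)] (normal y x) x"
proof -
  have xy: "(x, y) \<in> r" using assms by auto
  then have P: "x \<in> P" "y \<in> P" using r_in by auto
  have c: "(clamp x, clamp y) \<in> r" "(clamp y, clamp x) \<in> r"
    using clamp_Weq[OF assms] clamp_range(3) P r_refl by auto
  note zn = zigzag_normal[OF P(2,1) c(2)]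
  have B: "Z y [Bwd (x, y)] x" using xy assms P by auto
  have "Zeq x [] (normal x y @ normal y x) x"
    by (rule zeq_trans[OF normal_refl[OF P(1) P(1) refl] zeq_sym[OF normal_trans[OF P(1,2,1) c]]])
  also have "Zeq x (normal x y @ normal y x) ([Fwd (x, y)] @ normal y x) x"
    by (rule zeq_append[OF zeq_sym[OF Zeq_Fwd_normal[OF xy]] zeq_refl[OF zn]])
  finally have "Zeq x [] (Fwd (x, y) # normal y x) x" by simp
  from zeq_append[OF zeq_refl[OF B] this]
  have "Zeq y [Bwd (x, y)] ([Bwd (x, y), Fwd (x, y)] @ normal y x) x" by simp
  also have "Zeq y ([Bwd (x, y), Fwd (x, y)] @ normal y x) ([] @ normal y x) x"
    by (rule zeq_append[OF Zeq_Bwd_Fwd[OF assms] zeq_refl[OF zn]])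
  finally show ?thesis by simp
qed

text \<open>Each step is equal to a normal zigzag, and these compose. The first conjunct makes the
  normal zigzags well formed and also settles which hom-sets are nonempty.\<close>

lemma zigzag_Zeq_normal:
  "Z x us y \<Longrightarrow> (clamp x, clamp y) \<in> r \<and> Zeq x us (normal x y) y"
proof (induction us arbitrary: x)
  case Nil
  then show ?case using normal_refl clamp_range(3) r_refl by auto
next
  case (Cons s us)
  then obtain z where z: "Z z us y" and s: "(clamp x, clamp z) \<in> r" "Zeq x [s] (normal x z) z"
  proof (cases s)
    case (Fwd f)
    with Cons.prems show ?thesis
      by (cases f) (auto intro!: that clamp_mono Zeq_Fwd_normal)
  next
    case (Bwd w)
    with Cons.prems obtain z where w: "w = (z, x)" "(z, x) \<in> Weq" "Z z us y"
      by (cases w) auto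
    then have "(z, x) \<in> r" by auto
    then have "clamp z \<in> P" using r_in clamp_range(3) by blast
    then show ?thesis
      using Bwd w that[of z] Zeq_Bwd_normal clamp_Weq[OF w(2)] r_refl by auto
  qed
  note IH = Cons.IH[OF z]
  have P: "x \<in> P" "z \<in> P" "y \<in> P"
    using zigzag_obj[OF category_axioms z] zigzag_obj[OF category_axioms Cons.prems] by auto
  have "Zeq x ([s] @ us) (normal x z @ normal z y) y"
    using zeq_append[OF s(2)] IH by blast
  then have "Zeq x (s # us) (normal x y) y"
    using zeq_trans normal_trans[OF P(1,2,3) s(1)] IH by fastforce
  then show ?case using s(1) IH r_trans by blast
qed

section \<open>Thinness of the localization and the equivalence with the interval\<close>

lemma Hom_localization_iff:
  assumes "x \<in> P" "y \<in> P"
  shows "Hom (localization C Weq) x y \<noteq> {} \<longleftrightarrow> (clamp x, clamp y) \<in> r"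
  unfolding Hom_localization using zigzag_Zeq_normal zigzag_normal[OF assms] by blast

text \<open>Parallel zigzags share their normal form.\<close>

lemma thin_localization: "thin (localization C Weq)"
proof -
  have "zclass C Weq x us y = zclass C Weq x vs y" if "Z x us y" "Z x vs y" for x y us vs
  proof -
    have "Zeq x us vs y"
      using that zigzag_Zeq_normal by (blast intro: zeq_sym zeq_trans)
    then show ?thesis
      using zclass_eq_iff[OF that(1)] by blast
  qed
  then show ?thesis
    unfolding thin_def Hom_localization by blast
qed

text \<open>The object maps are \<open>clamp\<close> and the inclusion of the interval, on which
  \<open>clamp\<close> is the identity.\<close>

lemma localization_equivalent:
  "equivalent_categories (localization C Weq) (poset_cat {x \<in> P. (m, x) \<in> r \<and> (x, n) \<in> r} r)"
    (is "equivalent_categories ?L ?D")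
proof (rule equivalent_categories_thin[where Fo = clamp and Go = "\<lambda>x. x"])
  have L: "Obj ?L = P" by (simp add: localization_def)
  show "category ?L" by (rule category_localization[OF category_axioms])
  show "category ?D" by (rule category_poset_cat) auto
  show "thin ?L" by (rule thin_localization)
  show "thin ?D" by (rule thin_poset_cat)
  have idem: "clamp (clamp x) = clamp x" if "x \<in> P" for x
    using clamp_range[OF that] clamp_mid by blast
  show "clamp x \<in> Obj ?D" if "x \<in> Obj ?L" for x
    using clamp_range that L by auto
  show "y \<in> Obj ?L" if "y \<in> Obj ?D" for y
    using that L by auto
  show "Hom ?D (clamp x) (clamp x') \<noteq> {}" if "Hom ?L x x' \<noteq> {}" for x x'
  proof -
    have "x \<in> P" "x' \<in> P"
      using that zigzag_obj[OF category_axioms] unfolding Hom_localization by auto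
    then have "(clamp x, clamp x') \<in> Hom ?D (clamp x) (clamp x')"
      using that Hom_localization_iff clamp_range by simp
    then show ?thesis by blast
  qed
  show "Hom ?L y y' \<noteq> {}" if "Hom ?D y y' \<noteq> {}" for y y'
  proof -
    have "y \<in> P" "y' \<in> P" "(y, y') \<in> r" using that by auto
    then show ?thesis using Hom_localization_iff clamp_mono by blast
  qed
  \<comment> \<open>By idempotence \<open>x\<close> and \<open>clamp x\<close> have the same clamp,
    so reflexivity yields arrows both ways.\<close>
  show "Hom ?L (clamp x) x \<noteq> {} \<and> Hom ?L x (clamp x) \<noteq> {}" if "x \<in> Obj ?L" for x
    using that L Hom_localization_iff clamp_range idem r_refl by simp
  show "Hom ?D (clamp y) y \<noteq> {} \<and> Hom ?D y (clamp y) \<noteq> {}" if "y \<in> Obj ?D" for y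
  proof -
    have "clamp y = y" using that clamp_mid by simp
    moreover have "(y, y) \<in> Hom ?D y y" using that r_refl by simp
    ultimately show ?thesis by auto
  qed
qed

end

theorem proposition6p10:
  fixes P :: "'a set" and r :: "'a rel" and m n :: 'a
  assumes "partial_order_on P r"
    and "is_cut P r m" and "is_cut P r n" and "(m, n) \<in> r"
    and "m = n \<longrightarrow> \<not> (\<exists>a \<in> P. \<exists>c \<in> P. strict r a m \<and> strict r m c)"
  shows "let C = poset_cat P r; CoFib = below_class P r n; Fib = above_class P r m;
           Weq = below_class P r m \<union> above_class P r n in
    torsion_model_structure C CoFib Fib Weq \<and>
    bireflective_model_structure C CoFib Fib Weq \<and>
    {x. cofibrant C CoFib Fib Weq x} = {x \<in> P. (x, n) \<in> r} \<and>
    {x. fibrant C CoFib Fib Weq x} = {x \<in> P. (m, x) \<in> r} \<and>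
    equivalent_categories (homotopy_category C CoFib Fib Weq)
      (poset_cat {x \<in> P. (m, x) \<in> r \<and> (x, n) \<in> r} r)"
proof -
  interpret cut_pair P r m n
    using assms by unfold_locales
  show ?thesis
    unfolding Let_def homotopy_category_def
    using torsion_model_structure_axioms bireflective_model_structure_axioms
      localization_equivalent r_in by (auto simp: cofibrant_iff fibrant_iff)
qed

end
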